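(* Let $\mathcal{A} := (A, *, \{\,,\,,\,\}, \beta)$ be a Hom-Bol algebra. For each integer $n \geq 0$, the Hom-algebra $\mathcal{A}_n := (A, *_n, \{\,,\,,\,\}_n, \beta^{n+1})$, where $x *_n y := \beta^n(x*y)$ and $\{x,y,z\}_n := \beta^{2n}(\{x,y,z\})$ for all $x,y,z\in A$, is a Hom-Bol algebra.
   Context: All vector spaces are over a fixed ground field of characteristic $0$. Binary and ternary operations are bilinear and trilinear maps respectively. For a linear self-map $\beta$, $\beta^k$ is the $k$-fold composition, with $\beta^0=\mathrm{Id}$. $\circlearrowleft_{x,y,z}$ denotes the sum over cyclic permutations of $x,y,z$. A Hom-Bol algebra is a quadruple $(A, *, \{\,,\,,\,\}, \alpha)$ in which $A$ is a vector space, $*$ a binary operation and $\{\,,\,,\,\}$ a ternary operation on $A$, and $\alpha : A \to A$ a linear map such that for all $u,v,w,x,y,z \in A$: (HB1) $\alpha(x*y) = \alpha(x)*\alpha(y)$; (HB2) $\alpha(\{x,y,z\}) = \{\alpha(x),\alpha(y),\alpha(z)\}$; (HB3) $x*y = -y*x$; (HB4) $\{x,y,z\} = -\{y,x,z\}$; (HB5) $\circlearrowleft_{x,y,z}\{x,y,z\} = 0$; (HB6) $\{\alpha(x),\alpha(y),u*v\} = \{x,y,u\}*\alpha^2(v) + \alpha^2(u)*\{x,y,v\} + \{\alpha(u),\alpha(v),x*y\} - (\alpha(u)*\alpha(v))*(\alpha(x)*\alpha(y))$; (HB7) $\{\alpha^2(x),\alpha^2(y),\{u,v,w\}\} = \{\{x,y,u\},\alpha^2(v),\alpha^2(w)\}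 + \{\alpha^2(u),\{x,y,v\},\alpha^2(w)\} + \{\alpha^2(u),\alpha^2(v),\{x,y,w\}\}$. *)

theory Defs
  imports Complex_Main
begin

definition bilinear_op ::
  "('k::field \<Rightarrow> 'a::ab_group_add \<Rightarrow> 'a) \<Rightarrow> ('a \<Rightarrow> 'a \<Rightarrow> 'a) \<Rightarrow> bool"
where
  "bilinear_op s m \<longleftrightarrow>
     (\<forall>y. Vector_Spaces.linear s s (\<lambda>x. m x y)) \<and>
     (\<forall>x. Vector_Spaces.linear s s (\<lambda>y. m x y))"

definition trilinear_op ::
  "('k::field \<Rightarrow> 'a::ab_group_add \<Rightarrow> 'a) \<Rightarrow> ('a \<Rightarrow> 'a \<Rightarrow> 'a \<Rightarrow> 'a) \<Rightarrow> bool"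
where
  "trilinear_op s t \<longleftrightarrow>
     (\<forall>y z. Vector_Spaces.linear s s (\<lambda>x. t x y z)) \<and>
     (\<forall>x z. Vector_Spaces.linear s s (\<lambda>y. t x y z)) \<and>
     (\<forall>x y. Vector_Spaces.linear s s (\<lambda>z. t x y z))"

text \<open>
  The underlying vector space is the whole type \<open>'a\<close>, with scalar multiplication \<open>scale\<close>
  over an arbitrary field of characteristic 0. The map \<open>\<alpha>\<close> is part of the structure and
  is not assumed to be injective or surjective.
\<close>

locale hom_bol_algebra = vector_space scale
  for scale :: "'k::field_char_0 \<Rightarrow> 'a::ab_group_add \<Rightarrow> 'a" +
  fixes mult :: "'a \<Rightarrow> 'a \<Rightarrow> 'a"  (infixl \<open>\<star>\<close> 70)
    and triple :: "'a \<Rightarrow> 'a \<Rightarrow> 'a \<Rightarrow> 'a"  (\<open>\<lbrace>_,_,_\<rbrace>\<close>)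
    and \<alpha> :: "'a \<Rightarrow> 'a"
  assumes bilinear_mult: "bilinear_op scale (\<star>)"
    and trilinear_triple: "trilinear_op scale triple"
    and linear_twist: "Vector_Spaces.linear scale scale \<alpha>"
    and HB1: "\<alpha> (x \<star> y) = \<alpha> x \<star> \<alpha> y"
    and HB2: "\<alpha> \<lbrace>x, y, z\<rbrace> = \<lbrace>\<alpha> x, \<alpha> y, \<alpha> z\<rbrace>"
    and HB3: "x \<star> y = - (y \<star> x)"
    and HB4: "\<lbrace>x, y, z\<rbrace> = - \<lbrace>y, x, z\<rbrace>"
    and HB5: "\<lbrace>x, y, z\<rbrace> + \<lbrace>y, z, x\<rbrace> + \<lbrace>z, x, y\<rbrace> = 0"
    and HB6: "\<lbrace>\<alpha> x, \<alpha> y, u \<star> v\<rbrace> =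
       \<lbrace>x, y, u\<rbrace> \<star> (\<alpha> ^^ 2) v + (\<alpha> ^^ 2) u \<star> \<lbrace>x, y, v\<rbrace>
       + \<lbrace>\<alpha> u, \<alpha> v, x \<star> y\<rbrace> - (\<alpha> u \<star> \<alpha> v) \<star> (\<alpha> x \<star> \<alpha> y)"
    and HB7: "\<lbrace>(\<alpha> ^^ 2) x, (\<alpha> ^^ 2) y, \<lbrace>u, v, w\<rbrace>\<rbrace> =
       \<lbrace>\<lbrace>x, y, u\<rbrace>, (\<alpha> ^^ 2) v, (\<alpha> ^^ 2) w\<rbrace>
       + \<lbrace>(\<alpha> ^^ 2) u, \<lbrace>x, y, v\<rbrace>, (\<alpha> ^^ 2) w\<rbrace>
       + \<lbrace>(\<alpha> ^^ 2) u, (\<alpha> ^^ 2) v, \<lbrace>x, y, w\<rbrace>\<rbrace>"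

end

theory Submission imports Defs begin

text \<open>
  The theorem is an instance of a twisting principle. Let \<open>\<gamma>\<close> be a linear endomorphism of both
  operations of a Hom-Bol algebra that commutes with its twisting map \<open>\<alpha>\<close>. Then \<open>\<gamma>\<close> applied to the
  product, \<open>\<gamma>\<^sup>2\<close> applied to the triple product, and \<open>\<gamma> \<circ> \<alpha>\<close> form a Hom-Bol algebra again
  (\<open>twist_by_endomorphism\<close>). The reason is homogeneity. Give the product weight 1, the triple
  product weight 2 and \<open>\<alpha>\<close> weight 1. In each axiom every path from an argument to the root of a term
  then has the same total weight \<open>d\<close>: 2 in (HB1), 3 in (HB2) and (HB6), 4 in (HB7), and 1 or 2 in
  the remaining ones. Since \<open>\<gamma>\<close> passes through all operations, each twisted term is \<open>\<gamma>\<^sup>d\<close> of the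
  original term, and the twisted axiom is the image under the linear map \<open>\<gamma>\<^sup>d\<close> of the original one.

  By (HB1) and (HB2) the twisting map \<open>\<beta>\<close> is itself an endomorphism, hence so is \<open>\<beta>\<^sup>n\<close>, and the
  twist by \<open>\<gamma> = \<beta>\<^sup>n\<close> is the \<open>n\<close>-th derived algebra.
\<close>

lemma bilinear_op_compose:
  assumes "bilinear_op s m" and "Vector_Spaces.linear s s f"
  shows "bilinear_op s (\<lambda>x y. f (m x y))"
  using assms Vector_Spaces.linear_compose[of s s _ s f]
  unfolding bilinear_op_def comp_def by blast

lemma trilinear_op_compose:
  assumes "trilinear_op s t" and "Vector_Spaces.linear s s f"
  shows "trilinear_op s (\<lambda>x y z. f (t x y z))"
  using assms Vector_Spaces.linear_compose[of s s _ s f]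
  unfolding trilinear_op_def comp_def by blast

context hom_bol_algebra
begin

lemma linear_twist_funpow: "Vector_Spaces.linear scale scale (\<alpha> ^^ n)"
proof (induction n)
  case 0
  show ?case using linear_id by (simp add: id_def)
next
  case (Suc n)
  show ?case
    using Vector_Spaces.linear_compose[OF Suc.IH linear_twist] by (simp add: comp_def)
qed

lemma twist_funpow_mult: "(\<alpha> ^^ n) (x \<star> y) = (\<alpha> ^^ n) x \<star> (\<alpha> ^^ n) y"
  by (induction n) (simp_all add: HB1)

lemma twist_funpow_triple: "(\<alpha> ^^ n) \<lbrace>x, y, z\<rbrace> = \<lbrace>(\<alpha> ^^ n) x, (\<alpha> ^^ n) y, (\<alpha> ^^ n) z\<rbrace>"
  by (induction n) (simp_all add: HB2)

text \<open>
  The triple product receives the square of \<open>\<gamma>\<close> because (HB6) compares a triple product of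
  \<open>\<alpha>\<close>-images with a product of two products of \<open>\<alpha>\<close>-images: it is homogeneous only when the triple
  product weighs twice as much as the product.
\<close>

lemma twist_by_endomorphism:
  assumes lin: "Vector_Spaces.linear scale scale \<gamma>"
    and mult: "\<And>x y. \<gamma> (x \<star> y) = \<gamma> x \<star> \<gamma> y"
    and triple: "\<And>x y z. \<gamma> \<lbrace>x, y, z\<rbrace> = \<lbrace>\<gamma> x, \<gamma> y, \<gamma> z\<rbrace>"
    and commute: "\<And>x. \<gamma> (\<alpha> x) = \<alpha> (\<gamma> x)"
  shows "hom_bol_algebra scale
           (\<lambda>x y. \<gamma> (x \<star> y)) (\<lambda>x y z. \<gamma> (\<gamma> \<lbrace>x, y, z\<rbrace>)) (\<lambda>x. \<gamma> (\<alpha> x))"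
proof -
  interpret \<gamma>: Vector_Spaces.linear scale scale \<gamma> by (fact lin)
  have square: "(f ^^ 2) x = f (f x)" for f :: "'a \<Rightarrow> 'a" and x
    by (simp add: numeral_2_eq_2)
  \<comment> \<open>These rules push \<open>\<gamma>\<close> and \<open>\<alpha>\<close> to the arguments. A twisted axiom of weight \<open>d\<close> and the original
    axiom at the arguments \<open>\<gamma>\<^sup>d x, \<gamma>\<^sup>d y, \<dots>\<close> then have the same normal form.\<close>
  note push = mult triple commute HB1 HB2 square
  show ?thesis
  proof (intro hom_bol_algebra.intro hom_bol_algebra_axioms.intro, goal_cases)
    case 1
    show ?case by (fact vector_space_axioms)
  next
    case 2
    show ?case using bilinear_op_compose[OF bilinear_mult lin] .
  next
    case 3
    show ?case
      using trilinear_op_compose[OF trilinear_op_compose[OF trilinear_triple lin] lin] .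
  next
    case 4
    show ?case using Vector_Spaces.linear_compose[OF linear_twist lin] by (simp add: comp_def)
  next
    case (5 x y)
    show ?case by (simp add: push)
  next
    case (6 x y z)
    show ?case by (simp add: push)
  next
    case (7 x y)
    show ?case using HB3[of x y] \<gamma>.neg by metis
  next
    case (8 x y z)
    show ?case using HB4[of x y z] \<gamma>.neg by metis
  next
    case (9 x y z)
    show ?case using HB5[of x y z] by (simp flip: \<gamma>.add)
  next
    case (10 x y u v)
    show ?case
      using HB6[of "\<gamma> (\<gamma> (\<gamma> x))" "\<gamma> (\<gamma> (\<gamma> y))" "\<gamma> (\<gamma> (\<gamma> u))" "\<gamma> (\<gamma> (\<gamma> v))"]
      by (simp add: push)
  next
    case (11 x y u v w)
    show ?case
      using HB7[of "\<gamma> (\<gamma> (\<gamma> (\<gamma> x)))" "\<gamma> (\<gamma> (\<gamma> (\<gamma> y)))"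
          "\<gamma> (\<gamma> (\<gamma> (\<gamma> u)))" "\<gamma> (\<gamma> (\<gamma> (\<gamma> v)))" "\<gamma> (\<gamma> (\<gamma> (\<gamma> w)))"]
      by (simp add: push)
  qed
qed

end

theorem theorem3p6:
  fixes scale :: "'k::field_char_0 \<Rightarrow> 'a::ab_group_add \<Rightarrow> 'a"
    and mult :: "'a \<Rightarrow> 'a \<Rightarrow> 'a"
    and triple :: "'a \<Rightarrow> 'a \<Rightarrow> 'a \<Rightarrow> 'a"
    and \<beta> :: "'a \<Rightarrow> 'a"
    and n :: nat
  assumes "hom_bol_algebra scale mult triple \<beta>"
  shows "hom_bol_algebra scale
           (\<lambda>x y. (\<beta> ^^ n) (mult x y))
           (\<lambda>x y z. (\<beta> ^^ (2 * n)) (triple x y z))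
           (\<beta> ^^ (n + 1))"
proof -
  interpret hom_bol_algebra scale mult triple \<beta> by (fact assms)
  have "hom_bol_algebra scale (\<lambda>x y. (\<beta> ^^ n) (mult x y))
          (\<lambda>x y z. (\<beta> ^^ n) ((\<beta> ^^ n) (triple x y z))) (\<lambda>x. (\<beta> ^^ n) (\<beta> x))"
    by (intro twist_by_endomorphism linear_twist_funpow twist_funpow_mult twist_funpow_triple
        funpow_swap1[symmetric])
  moreover have "(\<beta> ^^ n) ((\<beta> ^^ n) x) = (\<beta> ^^ (2 * n)) x" for x
    by (simp add: mult_2 funpow_add)
  moreover have "(\<lambda>x. (\<beta> ^^ n) (\<beta> x)) = \<beta> ^^ (n + 1)"
    by (simp add: fun_eq_iff funpow_swap1)
  ultimately show ?thesis by simp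
qed

end
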